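(* Let $n\ge 1$ be an integer, and write $x=(x',x_n)\in\mathbb{C}^n$ with $x'=(x_1,\dots,x_{n-1})$. Then for every $x=(x',x_n)$ close enough to $0\in\mathbb{C}^n$, $$G_n(x)=\frac{1}{2\pi i}\int_0^{(1+)}G_{n-1}\Bigl(\frac{t\,x'}{(t-1)(1-x_nt)}\Bigr)\,\frac{dt}{(t-1)(1-x_nt)},$$ where the integration contour is a closed path starting from (and returning to) the origin $t=0$ and making one circle around $t=1$ in the counterclockwise sense.
   Context: For an integer $n\ge 1$, $G_n$ is the germ of analytic function at $0\in\mathbb{C}^n$ given by the convergent power series $$G_n(x)=\sum_{\ell\in\mathbb{N}^n}\Bigl(\frac{|\ell|!}{\ell!}\Bigr)^2x^\ell ,$$ where $\mathbb{N}=\{0,1,2,\dots\}$, $\ell=(\ell_1,\dots,\ell_n)$, $x^\ell=x_1^{\ell_1}\cdots x_n^{\ell_n}$, $|\ell|=\ell_1+\dots+\ell_n$, $\ell!=\ell_1!\cdots\ell_n!$. By convention $G_0\equiv 1$ (so for $n=1$ there is no variable $x'$). The contour is fixed, and "close enough" is relative to the chosen contour. The expression $\frac{t\,x'}{(t-1)(1-x_nt)}$ is the vector $x'$ multiplied by the scalar $\frac{t}{(t-1)(1-x_nt)}$. *)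

theory Defs
  imports "HOL-Complex_Analysis.Complex_Analysis"
begin

text \<open>
  A point of $\mathbb{C}^n$ is a function \<open>x :: nat \<Rightarrow> complex\<close> of which only the
  coordinates \<open>x 1, \<dots>, x n\<close> matter, so that \<open>G (n - 1) x\<close> is a function of
  $x' = (x_1,\dots,x_{n-1})$ alone. Multi-indices are the extensional functions
  on \<open>{1..n}\<close>, so each element of $\mathbb{N}^n$ is counted exactly once.
\<close>

definition G_term :: "nat \<Rightarrow> (nat \<Rightarrow> complex) \<Rightarrow> (nat \<Rightarrow> nat) \<Rightarrow> complex" where
  "G_term n x l =
     (fact (\<Sum>i=1..n. l i) / (\<Prod>i=1..n. fact (l i)))\<^sup>2 * (\<Prod>i=1..n. x i ^ l i)"

definition G :: "nat \<Rightarrow> (nat \<Rightarrow> complex) \<Rightarrow> complex" where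
  "G n x = (\<Sum>\<^sub>\<infinity>l\<in>{1..n} \<rightarrow>\<^sub>E (UNIV :: nat set). G_term n x l)"

lemma G_0: "G 0 x = 1"
  by (simp add: G_def G_term_def)

lemma G_cong:
  assumes "\<And>i. i \<in> {1..n} \<Longrightarrow> x i = y i"
  shows "G n x = G n y"
proof -
  have "G_term n x l = G_term n y l" for l
    unfolding G_term_def using assms by (auto intro!: prod.cong)
  then show ?thesis
    by (simp add: G_def)
qed

lemma fact_sum_le:
  assumes "finite I"
  shows "fact (\<Sum>i\<in>I. l i) \<le> (2 ^ card I) ^ (\<Sum>i\<in>I. l i) * (\<Prod>i\<in>I. fact (l i) :: nat)"
  using assms
proof (induction I rule: finite_induct)
  case empty
  then show ?case by simp
next
  case (insert a I)
  define s where "s = (\<Sum>i\<in>I. l i)"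
  define P where "P = (\<Prod>i\<in>I. fact (l i) :: nat)"
  have IH: "fact s \<le> (2 ^ card I) ^ s * P"
    using insert by (simp add: s_def P_def)
  have "fact (l a + s) = fact (l a) * fact s * ((l a + s) choose l a)"
    using binomial_fact_lemma[of "l a" "l a + s"] by simp
  also have "\<dots> \<le> fact (l a) * ((2 ^ card I) ^ s * P) * 2 ^ (l a + s)"
    by (intro mult_mono IH binomial_le_pow2) auto
  also have "\<dots> \<le> fact (l a) * ((2 ^ card I) ^ (l a + s) * P) * 2 ^ (l a + s)"
    by (intro mult_mono power_increasing) auto
  also have "\<dots> = (2 ^ Suc (card I)) ^ (l a + s) * (fact (l a) * P)"
    by (simp add: power_mult_distrib)
  finally show ?case
    using insert by (simp add: s_def P_def)
qed

lemma summable_on_prod_geometric: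
  fixes c :: real
  assumes "finite I" "0 \<le> c" "c < 1"
  shows "(\<lambda>l. \<Prod>i\<in>I. c ^ l i) summable_on (I \<rightarrow>\<^sub>E (UNIV :: nat set))"
proof (rule nonneg_bdd_above_summable_on)
  show "bdd_above (sum (\<lambda>l. \<Prod>i\<in>I. c ^ l i) ` {F. F \<subseteq> I \<rightarrow>\<^sub>E (UNIV :: nat set) \<and> finite F})"
  proof (rule bdd_aboveI2)
    fix F assume "F \<in> {F. F \<subseteq> I \<rightarrow>\<^sub>E (UNIV :: nat set) \<and> finite F}"
    then have F: "F \<subseteq> I \<rightarrow>\<^sub>E (UNIV :: nat set)" "finite F" by auto
    define N where "N = Max (insert 0 ((\<lambda>(l, i). l i) ` (F \<times> I)))"
    have N: "l i \<le> N" if "l \<in> F" "i \<in> I" for l i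
      unfolding N_def using that F(2) assms(1) by (intro Max_ge) auto
    have sub: "F \<subseteq> I \<rightarrow>\<^sub>E {..N}"
    proof
      fix l assume l: "l \<in> F"
      then have "l \<in> extensional I"
        using F(1) by (auto simp: PiE_def)
      with N[OF l] show "l \<in> I \<rightarrow>\<^sub>E {..N}"
        by (simp add: PiE_iff)
    qed
    have "(\<Sum>l\<in>F. \<Prod>i\<in>I. c ^ l i) \<le> (\<Sum>l\<in>I \<rightarrow>\<^sub>E {..N}. \<Prod>i\<in>I. c ^ l i)"
      using sub assms by (intro sum_mono2 finite_PiE prod_nonneg) auto
    also have "\<dots> = (\<Prod>i\<in>I. \<Sum>k\<in>{..N}. c ^ k)"
      using assms(1) by (intro prod_sum_PiE[symmetric]) auto
    also have "\<dots> \<le> (\<Prod>i\<in>I. \<Sum>k. c ^ k)"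
      using assms by (intro prod_mono conjI sum_nonneg sum_le_suminf summable_geometric) auto
    finally show "(\<Sum>l\<in>F. \<Prod>i\<in>I. c ^ l i) \<le> (\<Prod>i\<in>I. \<Sum>k. c ^ k)" .
  qed
qed (use assms in \<open>auto intro!: prod_nonneg\<close>)

text \<open>
  Near the origin the series converges absolutely, so \<open>G n\<close> is its genuine sum there;
  \<open>infsum\<close> returns the junk value 0 only away from the origin.
\<close>

lemma G_term_abs_summable:
  "\<exists>\<epsilon>>0. \<forall>x. (\<forall>i\<in>{1..n}. norm (x i) < \<epsilon>) \<longrightarrow>
     (\<lambda>l. norm (G_term n x l)) summable_on ({1..n} \<rightarrow>\<^sub>E (UNIV :: nat set))"
proof (intro exI[of _ "1 / (2 * 4 ^ n)"] conjI allI impI)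
  fix x :: "nat \<Rightarrow> complex"
  assume x: "\<forall>i\<in>{1..n}. norm (x i) < 1 / (2 * 4 ^ n)"
  show "(\<lambda>l. norm (G_term n x l)) summable_on ({1..n} \<rightarrow>\<^sub>E (UNIV :: nat set))"
  proof (rule summable_on_comparison_test)
    show "(\<lambda>l. \<Prod>i\<in>{1..n}. (1/2 :: real) ^ l i) summable_on ({1..n} \<rightarrow>\<^sub>E (UNIV :: nat set))"
      by (rule summable_on_prod_geometric) auto
  next
    fix l :: "nat \<Rightarrow> nat"
    define s where "s = (\<Sum>i=1..n. l i)"
    define P where "P = (\<Prod>i=1..n. fact (l i) :: nat)"
    have P: "P > 0" by (auto simp: P_def intro: prod_pos)
    have "fact s \<le> (2 ^ n) ^ s * P"
      using fact_sum_le[of "{1..n}" l] by (simp add: s_def P_def)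
    then have "real (fact s) \<le> real ((2 ^ n) ^ s * P)"
      by (rule of_nat_mono)
    then have q: "fact s / real P \<le> (2 ^ n) ^ s"
      using P by (simp add: field_simps)
    have x': "norm (x i) \<le> 1 / (2 * 4 ^ n)" if "Suc 0 \<le> i" "i \<le> n" for i
      using x that by (simp add: less_imp_le)
    have "norm (G_term n x l) = (fact s / real P)\<^sup>2 * (\<Prod>i=1..n. norm (x i) ^ l i)"
      by (simp add: G_term_def s_def P_def norm_mult norm_power norm_divide norm_fact
          flip: prod_norm)
    also have "\<dots> \<le> ((2 ^ n) ^ s)\<^sup>2 * (\<Prod>i=1..n. (1 / (2 * 4 ^ n)) ^ l i)"
      using x' q by (intro mult_mono power_mono prod_mono prod_nonneg) (auto intro!: power_mono)
    also have "((2 ^ n) ^ s :: real)\<^sup>2 = ((2\<^sup>2) ^ n) ^ s"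
      by (simp only: mult_ac flip: power_mult)
    also have "\<dots> = (4 ^ n) ^ s"
      by simp
    also have "\<dots> = (\<Prod>i=1..n. (4 ^ n) ^ l i)"
      by (simp add: s_def power_sum)
    also have "\<dots> * (\<Prod>i=1..n. (1 / (2 * 4 ^ n)) ^ l i) = (\<Prod>i=1..n. (1/2 :: real) ^ l i)"
      unfolding prod.distrib[symmetric] power_mult_distrib[symmetric] by simp
    finally show "norm (G_term n x l) \<le> (\<Prod>i\<in>{1..n}. (1/2) ^ l i)" .
  qed auto
qed auto

end

theory Submission
  imports Defs
begin

text \<open>
  Write \<open>m = |l'|\<close> and \<open>k = l n\<close>. Expanding \<open>G (n - 1)\<close> and then \<open>(1 - x n * t)\<close> to the power
  \<open>- (m + 1)\<close> turns the integrand into a series over multi-indices \<open>l = (l', k)\<close>, in which \<open>t\<close>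
  occurs only through \<open>t ^ (m + k) / (t - 1) ^ (m + 1)\<close>. The residue of this function at \<open>1\<close> is
  \<open>(m + k) choose m\<close>, which supplies exactly the missing factor of the squared multinomial
  coefficient of \<open>l\<close>. On a neighbourhood of the contour that stays away from \<open>1\<close> and \<open>\<infinity>\<close> the
  series is dominated by that of \<open>G n\<close> at \<open>K * x\<close> for a constant \<open>K\<close>, so it may be integrated
  termwise when \<open>x\<close> is small.
\<close>

section \<open>The negative binomial series\<close>

lemma binomial_series_has_sum:
  fixes z :: complex
  assumes "norm z < 1"
  shows "((\<lambda>k. of_nat ((m + k) choose m) * z ^ k) has_sum (1 / (1 - z) ^ Suc m)) UNIV"
proof -
  \<comment> \<open>Proved for every \<open>w\<close>: at \<open>z\<close> it gives the value, at
    \<open>norm z\<close> the absolute convergence that upgrades \<open>sums\<close> to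
    \<open>has_sum\<close>.\<close>
  have sums: "(\<lambda>k. of_nat ((m + k) choose m) * w ^ k) sums (1 / (1 - w) ^ Suc m)"
    if "norm w < 1" for w :: complex
  proof -
    have "1 - w \<noteq> 0"
      using that by auto
    then have "(1 + (- w)) powr (- of_nat (Suc m)) = 1 / (1 - w) ^ Suc m"
      using powr_nat'[of "1 - w" "Suc m"]
      by (simp only: powr_minus add_uminus_conv_diff inverse_eq_divide) simp
    moreover have "(-1) ^ k * ((of_nat (Suc m) + of_nat k - 1) gchoose k) * (- w) ^ k
        = of_nat ((m + k) choose m) * w ^ k" for k
    proof -
      have "(of_nat (Suc m) + of_nat k - 1 :: complex) gchoose k = of_nat ((m + k) choose k)"
        by (simp add: binomial_gbinomial)
      moreover have "(m + k) choose k = (m + k) choose m"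
        using binomial_symmetric[of m "m + k"] by simp
      moreover have "(-1) ^ k * (- w) ^ k = w ^ k"
        by (simp flip: power_mult_distrib)
      ultimately show ?thesis
        by (simp add: mult_ac)
    qed
    ultimately show ?thesis
      using one_plus_neg_powr_powser[of "- w" "of_nat (Suc m)"] that by simp
  qed
  have "summable (\<lambda>k. of_nat ((m + k) choose m) * complex_of_real (norm z) ^ k)"
    using sums[of "of_real (norm z)"] assms by (simp add: sums_iff)
  then have "summable (\<lambda>k. complex_of_real (norm (of_nat ((m + k) choose m) * z ^ k)))"
    by (simp add: norm_mult norm_power)
  then have "summable (\<lambda>k. norm (of_nat ((m + k) choose m) * z ^ k))"
    by (simp only: summable_complex_of_real)
  then show ?thesis
    using sums[OF assms] by (rule norm_summable_imp_has_sum)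
qed

section \<open>Residues at a pole, counted with winding number\<close>

lemma has_contour_integral_power_div_power:
  assumes "valid_path \<gamma>" "pathfinish \<gamma> = pathstart \<gamma>" "z \<notin> path_image \<gamma>"
  shows "((\<lambda>t. (t - z) ^ j / (t - z) ^ Suc m) has_contour_integral
           (if j = m then 2 * pi * \<i> * winding_number \<gamma> z else 0)) \<gamma>"
proof (cases "j = m")
  case True
  then have "1 / (t - z) = (t - z) ^ j / (t - z) ^ Suc m" if "t \<in> path_image \<gamma>" for t
    using that assms(3) by auto
  then show ?thesis
    using has_contour_integral_eq[OF has_contour_integral_winding_number[OF assms(1,3)]] True
    by simp
next
  case False
  \<comment> \<open>The integrand is \<open>(t - z) powi (d - 1)\<close>; for
    \<open>d \<noteq> 0\<close> it has the single-valued primitive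
    \<open>(t - z) powi d / d\<close>, so its integral over a closed path vanishes.\<close>
  define d where "d = int j - int m"
  have "d \<noteq> 0"
    using False by (simp add: d_def)
  have "((\<lambda>t. (t - z) powi d / of_int d) has_field_derivative (t - z) ^ j / (t - z) ^ Suc m)
      (at t within path_image \<gamma>)" if "t \<in> path_image \<gamma>" for t
  proof -
    have "t - z \<noteq> 0"
      using that assms(3) by auto
    then have "(t - z) powi (d - 1) = (t - z) ^ j / (t - z) ^ Suc m"
      using power_int_diff[of "t - z" "int j" "int (Suc m)"]
      unfolding power_int_of_nat by (simp add: d_def algebra_simps)
    then show ?thesis
      using \<open>t - z \<noteq> 0\<close> \<open>d \<noteq> 0\<close> by (auto intro!: derivative_eq_intros)
  qed
  from Cauchy_theorem_primitive[OF this assms(1) order_refl assms(2)] False show ?thesis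
    by simp
qed

text \<open>Expand \<open>t ^ N = ((t - 1) + 1) ^ N\<close>; only the summand \<open>j = m\<close>,
  which has a simple pole, contributes.\<close>

lemma has_contour_integral_monomial_div_power:
  assumes "valid_path \<gamma>" "pathfinish \<gamma> = pathstart \<gamma>" "1 \<notin> path_image \<gamma>"
  shows "((\<lambda>t. t ^ N / (t - 1) ^ Suc m) has_contour_integral
           2 * pi * \<i> * winding_number \<gamma> 1 * of_nat (N choose m)) \<gamma>"
proof -
  have "((\<lambda>t. \<Sum>j\<le>N. of_nat (N choose j) * ((t - 1) ^ j / (t - 1) ^ Suc m)) has_contour_integral
     (\<Sum>j\<le>N. of_nat (N choose j) * (if j = m then 2 * pi * \<i> * winding_number \<gamma> 1 else 0))) \<gamma>"
    by (intro has_contour_integral_sum has_contour_integral_lmul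
        has_contour_integral_power_div_power assms finite_atMost)
  moreover have "(\<Sum>j\<le>N. of_nat (N choose j) * ((t - 1) ^ j / (t - 1) ^ Suc m))
      = t ^ N / (t - 1) ^ Suc m" for t :: complex
    using binomial_ring[of "t - 1" 1 N] by (simp add: sum_divide_distrib)
  \<comment> \<open>For \<open>m > N\<close> no summand survives, in agreement with
    \<open>N choose m = 0\<close>.\<close>
  moreover have "(\<Sum>j\<le>N. of_nat (N choose j) * (if j = m then 2 * pi * \<i> * winding_number \<gamma> 1 else 0))
      = 2 * pi * \<i> * winding_number \<gamma> 1 * of_nat (N choose m)"
    by (auto simp: if_distrib mult_ac not_le cong: if_cong)
  ultimately show ?thesis
    by simp
qed

section \<open>Uniform limits of holomorphic functions and of their contour integrals\<close>

lemma holomorphic_on_uniform_limit: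
  assumes "open S" "\<forall>\<^sub>F n in F. f n holomorphic_on S" "uniform_limit S f l F" "F \<noteq> bot"
  shows "l holomorphic_on S"
proof -
  \<comment> \<open>Holomorphy is local, so the limit theorem for discs is applied on closed balls
    inside \<open>S\<close>, where continuity up to the boundary is available.\<close>
  have "\<exists>r>0. l holomorphic_on ball z r" if "z \<in> S" for z
  proof -
    obtain r where r: "r > 0" "cball z r \<subseteq> S"
      using assms(1) \<open>z \<in> S\<close> open_contains_cball by blast
    have "\<forall>\<^sub>F n in F. continuous_on (cball z r) (f n) \<and> f n holomorphic_on ball z r"
      using assms(2)
    proof eventually_elim
      case (elim n)
      have "ball z r \<subseteq> S"
        using r(2) ball_subset_cball by blast
      then show ?case
        using holomorphic_on_imp_continuous_on[OF holomorphic_on_subset[OF elim r(2)]]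
          holomorphic_on_subset[OF elim] by simp
    qed
    then have "l holomorphic_on ball z r"
      by (rule holomorphic_uniform_limit[OF _ uniform_limit_on_subset[OF assms(3) r(2)] assms(4)])
    then show ?thesis
      using r(1) by blast
  qed
  then have "l analytic_on S"
    by (auto simp: analytic_on_def)
  then show ?thesis
    by (rule analytic_imp_holomorphic)
qed

text \<open>
  A valid path need not be rectifiable, since its derivative may be unbounded near the
  finitely many exceptional points; hence the detour through a nearby polynomial path.
\<close>

lemma contour_integral_uniform_limit_holomorphic:
  assumes S: "open S" and hol: "\<forall>\<^sub>F n in F. f n holomorphic_on S"
    and lim: "uniform_limit S f l F" and F: "F \<noteq> bot"
    and g: "valid_path g" "path_image g \<subseteq> S"
  shows "((\<lambda>n. contour_integral g (f n)) \<longlongrightarrow> contour_integral g l) F"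
proof -
  obtain d where d: "d > 0" and nearby: "\<forall>g' h. valid_path g' \<and> valid_path h \<and>
      (\<forall>t\<in>{0..1}. norm (g' t - g t) < d \<and> norm (h t - g t) < d) \<and>
      pathstart h = pathstart g' \<and> pathfinish h = pathfinish g' \<longrightarrow>
      path_image g' \<subseteq> S \<and> path_image h \<subseteq> S \<and>
      (\<forall>f. f holomorphic_on S \<longrightarrow> contour_integral h f = contour_integral g' f)"
    by (rule exE[OF contour_integral_nearby_ends[OF S valid_path_imp_path[OF g(1)] g(2)]]) blast
  obtain p where p: "polynomial_function p" "pathstart p = pathstart g" "pathfinish p = pathfinish g"
      "\<And>t. t \<in> {0..1} \<Longrightarrow> norm (p t - g t) < d"
    using path_approx_polynomial_function[OF valid_path_imp_path[OF g(1)] d] by blast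
  have vp: "valid_path p"
    using p(1) by (rule valid_path_polynomial_function)
  \<comment> \<open>\<open>g\<close> is at distance 0 from itself, so it may serve as one of the two
    nearby paths and \<open>p\<close> as the other.\<close>
  have image: "path_image p \<subseteq> S"
    and eq: "\<And>f. f holomorphic_on S \<Longrightarrow> contour_integral p f = contour_integral g f"
    using nearby[rule_format, of g p] g(1) vp p d by auto
  obtain p' where p': "polynomial_function p'" "\<And>t. (p has_vector_derivative p' t) (at t)"
    using has_vector_derivative_polynomial_function[OF p(1)] by blast
  \<comment> \<open>The derivative of a polynomial path is continuous, hence bounded on
    \<open>{0..1}\<close>; this bound is what \<open>g\<close> itself may lack.\<close>
  have "compact (p' ` {0..1})"
    by (intro compact_continuous_image continuous_on_polymonial_function p' compact_Icc)
  then obtain B where "\<And>t. t \<in> {0..1} \<Longrightarrow> norm (p' t) \<le> B"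
    using compact_imp_bounded bounded_iff by (metis imageI)
  then have B: "norm (vector_derivative p (at t)) \<le> B" if "t \<in> {0..1}" for t
    using that p'(2) vector_derivative_at by metis
  have "\<forall>\<^sub>F n in F. f n contour_integrable_on p"
    using hol by eventually_elim (rule contour_integrable_holomorphic_simple[OF _ S vp image])
  then have "((\<lambda>n. contour_integral p (f n)) \<longlongrightarrow> contour_integral p l) F"
    by (rule contour_integral_uniform_limit(2)[OF _ uniform_limit_on_subset[OF lim image] B vp F])
  moreover have "\<forall>\<^sub>F n in F. contour_integral p (f n) = contour_integral g (f n)"
    using hol by eventually_elim (rule eq)
  \<comment> \<open>The integral of the limit can be moved from \<open>p\<close> back to
    \<open>g\<close> because the limit is again holomorphic on \<open>S\<close>.\<close>
  moreover have "contour_integral p l = contour_integral g l"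
    using holomorphic_on_uniform_limit[OF S hol lim F] by (rule eq)
  ultimately show ?thesis
    using tendsto_cong by force
qed

section \<open>The terms of the expanded integrand: integral, majorant and sum\<close>

lemma G_term_Suc:
  "G_term (Suc N) x l =
     G_term N x l * (of_nat (((\<Sum>i=1..N. l i) + l (Suc N)) choose (\<Sum>i=1..N. l i)))\<^sup>2
       * x (Suc N) ^ l (Suc N)"
proof -
  define m where "m = (\<Sum>i=1..N. l i)"
  \<comment> \<open>Splitting off the last index multiplies the multinomial coefficient by one
    binomial coefficient.\<close>
  have "of_nat ((m + l (Suc N)) choose m) = (fact (m + l (Suc N)) / (fact m * fact (l (Suc N))) :: complex)"
    using binomial_fact[of m "m + l (Suc N)", where ?'a = complex] by simp
  moreover have "(\<Prod>i=1..N. fact (l i) :: complex) \<noteq> 0"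
    by simp
  ultimately show ?thesis
    unfolding G_term_def m_def[symmetric]
    by (simp add: power_divide power_mult_distrib m_def[symmetric, simplified])
qed

lemma G_term_scale: "G_term N (\<lambda>i. c * x i) l = c ^ (\<Sum>i=1..N. l i) * G_term N x l"
  by (simp add: G_term_def power_mult_distrib prod.distrib power_sum)

text \<open>
  The \<open>l\<close>-th term of the expansion of the integrand in powers of \<open>x 1, \<dots>, x (N + 1)\<close>.
\<close>

definition kernel_term :: "nat \<Rightarrow> (nat \<Rightarrow> complex) \<Rightarrow> (nat \<Rightarrow> nat) \<Rightarrow> complex \<Rightarrow> complex" where
  "kernel_term N x l t =
     G_term N x l * of_nat (((\<Sum>i=1..N. l i) + l (Suc N)) choose (\<Sum>i=1..N. l i))
       * x (Suc N) ^ l (Suc N)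
       * (t ^ ((\<Sum>i=1..N. l i) + l (Suc N)) / (t - 1) ^ Suc (\<Sum>i=1..N. l i))"

text \<open>\<open>kernel_term\<close> carries the binomial coefficient once; the residue supplies
  the second copy needed for the square in \<open>G_term\<close>.\<close>

lemma has_contour_integral_kernel_term:
  assumes "valid_path \<gamma>" "pathfinish \<gamma> = pathstart \<gamma>" "1 \<notin> path_image \<gamma>" "winding_number \<gamma> 1 = 1"
  shows "(kernel_term N x l has_contour_integral 2 * pi * \<i> * G_term (Suc N) x l) \<gamma>"
  unfolding kernel_term_def G_term_Suc
  using has_contour_integral_lmul[OF has_contour_integral_monomial_div_power[OF assms(1-3)]]
  by (rule back_subst[of "\<lambda>I. (_ has_contour_integral I) \<gamma>"]) (simp add: assms(4) power2_eq_square)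

text \<open>The fraction in \<open>t\<close> equals
  \<open>1 / (t - 1) * (t / (t - 1)) ^ m * t ^ k\<close>, so each variable costs at most a factor
  \<open>K\<close>. The bound does not involve \<open>t\<close>, as the Weierstrass M-test
  requires.\<close>

lemma norm_kernel_term_le:
  assumes "norm t \<le> K" "norm (t / (t - 1)) \<le> K" "norm (1 / (t - 1)) \<le> C"
  shows "norm (kernel_term N x l t) \<le> C * norm (G_term (Suc N) (\<lambda>i. of_real K * x i) l)"
proof -
  define m k where "m = (\<Sum>i=1..N. l i)" and "k = l (Suc N)"
  define b where "b = (m + k) choose m"
  have "0 \<le> K"
    using assms(1) norm_ge_zero order_trans by blast
  \<comment> \<open>Since \<open>b \<ge> 1\<close>, the single binomial factor may be enlarged to
    the square occurring in \<open>G_term\<close>.\<close>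
  have "b \<ge> 1"
    by (simp add: b_def Suc_le_eq)
  then have b: "real b \<le> (real b)\<^sup>2"
    by (simp add: power2_eq_square)
  have "t ^ (m + k) / (t - 1) ^ Suc m = (1 / (t - 1)) * ((t / (t - 1)) ^ m * t ^ k)"
    by (simp add: power_add power_divide)
  then have "norm (t ^ (m + k) / (t - 1) ^ Suc m)
      = norm (1 / (t - 1)) * (norm (t / (t - 1)) ^ m * norm t ^ k)"
    by (simp only: norm_mult norm_power)
  also have "\<dots> \<le> C * (K ^ m * K ^ k)"
    using \<open>0 \<le> K\<close> order_trans[OF norm_ge_zero assms(3)]
    by (intro mult_mono power_mono assms) auto
  finally have t: "norm (t ^ (m + k) / (t - 1) ^ Suc m) \<le> C * (K ^ m * K ^ k)" .
  have "norm (kernel_term N x l t)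
      = norm (G_term N x l) * real b * norm (x (Suc N)) ^ k * norm (t ^ (m + k) / (t - 1) ^ Suc m)"
    unfolding kernel_term_def m_def[symmetric] k_def[symmetric] b_def[symmetric]
    by (simp only: norm_mult norm_power norm_of_nat)
  also have "\<dots> \<le> norm (G_term N x l) * (real b)\<^sup>2 * norm (x (Suc N)) ^ k * (C * (K ^ m * K ^ k))"
    by (intro mult_mono t b) auto
  also have "\<dots> = C * norm (G_term (Suc N) (\<lambda>i. of_real K * x i) l)"
    unfolding G_term_Suc unfolding G_term_scale m_def[symmetric] k_def[symmetric] b_def[symmetric]
    using \<open>0 \<le> K\<close> by (simp add: norm_mult norm_power power_mult_distrib mult_ac)
  finally show ?thesis .
qed

lemma bij_betw_fun_upd_PiE_Suc:
  "bij_betw (\<lambda>(l, k). l(Suc N := k)) (({1..N} \<rightarrow>\<^sub>E UNIV) \<times> UNIV) ({1..Suc N} \<rightarrow>\<^sub>E (UNIV :: nat set))"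
proof -
  have "{1..Suc N} = insert (Suc N) {1..N}"
    by auto
  then have "({1..Suc N} \<rightarrow>\<^sub>E (UNIV :: nat set)) = (\<lambda>(l, k). l(Suc N := k)) ` (({1..N} \<rightarrow>\<^sub>E UNIV) \<times> UNIV)"
    by (force simp: PiE_insert_eq image_def)
  then show ?thesis
    using inj_combinator'[of "Suc N" "{1..N}" "\<lambda>_. UNIV :: nat set"] by (simp add: bij_betw_def)
qed

text \<open>Summing over the last index first gives \<open>1 / (1 - z) ^ (m + 1)\<close>. Of the
  \<open>m + 1\<close> factors \<open>1 / ((t - 1) * (1 - z))\<close>, \<open>m\<close> join
  \<open>t ^ m\<close> to rescale the argument of \<open>G N\<close> by homogeneity, and one remains
  outside.\<close>

lemma infsum_kernel_term:
  assumes "norm (x (Suc N) * t) < 1"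
    and "(\<lambda>l. kernel_term N x l t) summable_on ({1..Suc N} \<rightarrow>\<^sub>E UNIV)"
  shows "(\<Sum>\<^sub>\<infinity>l\<in>{1..Suc N} \<rightarrow>\<^sub>E UNIV. kernel_term N x l t) =
     G N (\<lambda>i. t * x i / ((t - 1) * (1 - x (Suc N) * t))) * (1 / ((t - 1) * (1 - x (Suc N) * t)))"
proof -
  define z where "z = x (Suc N) * t"
  define c where "c = t / ((t - 1) * (1 - z))"
  have upd: "kernel_term N x (l(Suc N := k)) t =
      G_term N x l * (t ^ (\<Sum>i=1..N. l i) / (t - 1) ^ Suc (\<Sum>i=1..N. l i))
        * (of_nat (((\<Sum>i=1..N. l i) + k) choose (\<Sum>i=1..N. l i)) * z ^ k)" for l k
  proof -
    have "(\<Sum>i=1..N. (l(Suc N := k)) i) = (\<Sum>i=1..N. l i)"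
      by (intro sum.cong) auto
    moreover have "G_term N x (l(Suc N := k)) = G_term N x l"
      unfolding G_term_def by (intro arg_cong2[of _ _ _ _ "(*)"] arg_cong2[of _ _ _ _ "(/)"]
          arg_cong[of _ _ "\<lambda>u. u\<^sup>2"] arg_cong[of _ _ fact] sum.cong prod.cong) auto
    ultimately show ?thesis
      by (simp add: kernel_term_def z_def power_add power_mult_distrib)
  qed
  have inner: "(\<Sum>\<^sub>\<infinity>k. kernel_term N x (l(Suc N := k)) t)
      = G_term N (\<lambda>i. c * x i) l * (1 / ((t - 1) * (1 - z)))" for l
  proof -
    have "(\<Sum>\<^sub>\<infinity>k. of_nat ((m + k) choose m) * z ^ k) = 1 / (1 - z) ^ Suc m" for m
      using binomial_series_has_sum[of z m] assms(1) infsumI by (simp add: z_def)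
    then show ?thesis
      unfolding upd infsum_cmult_right' G_term_scale
      by (simp add: c_def power_divide power_mult_distrib mult_ac)
  qed
  have "(\<Sum>\<^sub>\<infinity>l\<in>{1..Suc N} \<rightarrow>\<^sub>E UNIV. kernel_term N x l t)
      = (\<Sum>\<^sub>\<infinity>(l, k)\<in>({1..N} \<rightarrow>\<^sub>E UNIV) \<times> UNIV. kernel_term N x (l(Suc N := k)) t)"
    using infsum_reindex_bij_betw[OF bij_betw_fun_upd_PiE_Suc, of "\<lambda>l. kernel_term N x l t" N]
    by (simp add: case_prod_unfold)
  \<comment> \<open>Joint summability from \<open>assms(2)\<close> justifies the iterated
    sum.\<close>
  also have "\<dots> = (\<Sum>\<^sub>\<infinity>l\<in>{1..N} \<rightarrow>\<^sub>E UNIV. \<Sum>\<^sub>\<infinity>k. kernel_term N x (l(Suc N := k)) t)"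
    using assms(2) summable_on_reindex_bij_betw[OF bij_betw_fun_upd_PiE_Suc, of "\<lambda>l. kernel_term N x l t" N]
    by (intro infsum_Sigma'_banach[symmetric]) (simp add: case_prod_unfold)
  also have "\<dots> = G N (\<lambda>i. c * x i) * (1 / ((t - 1) * (1 - z)))"
    unfolding inner G_def by (rule infsum_cmult_left')
  finally show ?thesis
    by (simp add: c_def z_def)
qed

section \<open>Choice of the neighbourhood of 0 and termwise integration\<close>

theorem theorem1p1:
  fixes n :: nat and \<gamma> :: "real \<Rightarrow> complex"
  assumes "n \<ge> 1"
    and "valid_path \<gamma>" and "pathstart \<gamma> = 0" and "pathfinish \<gamma> = 0"
    and "1 \<notin> path_image \<gamma>" and "winding_number \<gamma> 1 = 1"
  shows "\<exists>\<epsilon>>0. \<forall>x :: nat \<Rightarrow> complex. (\<forall>i\<in>{1..n}. norm (x i) < \<epsilon>) \<longrightarrow>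
    (\<lambda>t. G (n - 1) (\<lambda>i. t * x i / ((t - 1) * (1 - x n * t))) * (1 / ((t - 1) * (1 - x n * t))))
      contour_integrable_on \<gamma> \<and>
    G n x = 1 / (2 * of_real pi * \<i>) *
      contour_integral \<gamma>
        (\<lambda>t. G (n - 1) (\<lambda>i. t * x i / ((t - 1) * (1 - x n * t))) *
              (1 / ((t - 1) * (1 - x n * t))))"
proof -
  obtain N where n: "n = Suc N"
    using assms(1) by (cases n) auto
  have closed: "pathfinish \<gamma> = pathstart \<gamma>"
    using assms(3,4) by simp
  have compact: "compact (path_image \<gamma>)"
    using assms(2) by (intro compact_path_image valid_path_imp_path)
  obtain R where R: "R > 0" "path_image \<gamma> \<subseteq> ball 0 R"
    using bounded_subset_ballD[OF compact_imp_bounded[OF compact]] by blast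
  obtain \<delta> where \<delta>: "\<delta> > 0" "path_image \<gamma> \<inter> cball 1 \<delta> = {}"
  proof -
    have "open (- path_image \<gamma>)"
      using compact by (intro open_Compl compact_imp_closed)
    then show ?thesis
      using that assms(5) open_contains_cball[of "- path_image \<gamma>"] by blast
  qed
  \<comment> \<open>An open neighbourhood of the contour on which \<open>t\<close> and
    \<open>1 / (t - 1)\<close> are both bounded.\<close>
  define S where "S = ball 0 R - cball (1 :: complex) \<delta>"
  have S: "open S" "path_image \<gamma> \<subseteq> S" "1 \<notin> S"
    using R \<delta> by (auto simp: S_def)
  define K where "K = max R (R / \<delta>)"
  have "K > 0"
    using R by (simp add: K_def)
  have bounds: "norm t \<le> K" "norm (t / (t - 1)) \<le> K" "norm (1 / (t - 1)) \<le> 1 / \<delta>" if "t \<in> S" for t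
  proof -
    have t: "norm t < R" "\<delta> < norm (t - 1)"
      using that by (auto simp: S_def dist_norm norm_minus_commute)
    then show "norm t \<le> K"
      by (simp add: K_def)
    have "norm (t / (t - 1)) \<le> R / \<delta>"
      unfolding norm_divide using t \<delta> R by (intro frac_le) auto
    then show "norm (t / (t - 1)) \<le> K"
      by (simp add: K_def)
    show "norm (1 / (t - 1)) \<le> 1 / \<delta>"
      unfolding norm_divide using t \<delta> by (intro frac_le) auto
  qed
  obtain \<epsilon> where \<epsilon>: "\<epsilon> > 0" "\<And>x. (\<forall>i\<in>{1..n}. norm (x i) < \<epsilon>) \<Longrightarrow>
      (\<lambda>l. norm (G_term n x l)) summable_on ({1..n} \<rightarrow>\<^sub>E (UNIV :: nat set))"
    using G_term_abs_summable[of n] by blast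
  \<comment> \<open>The bound \<open>\<epsilon> / K\<close> puts \<open>K * x\<close> where the
    series of \<open>G n\<close> converges absolutely; \<open>1 / K\<close> forces
    \<open>norm (x n * t) < 1\<close> on \<open>S\<close>.\<close>
  show ?thesis
  proof (intro exI[of _ "min (\<epsilon> / K) (1 / K)"] conjI[of "_ > _"] allI impI)
    show "min (\<epsilon> / K) (1 / K) > 0"
      using \<epsilon>(1) \<open>K > 0\<close> by simp
  next
    fix x :: "nat \<Rightarrow> complex"
    assume x: "\<forall>i\<in>{1..n}. norm (x i) < min (\<epsilon> / K) (1 / K)"
    define I where "I = {1..n} \<rightarrow>\<^sub>E (UNIV :: nat set)"
    define f where "f t = G (n - 1) (\<lambda>i. t * x i / ((t - 1) * (1 - x n * t))) *
        (1 / ((t - 1) * (1 - x n * t)))" for t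
    define M where "M l = 1 / \<delta> * norm (G_term n (\<lambda>i. of_real K * x i) l)" for l
    have "\<forall>i\<in>{1..n}. norm (of_real K * x i) < \<epsilon>"
      using x \<open>K > 0\<close> by (auto simp: norm_mult field_simps)
    from \<epsilon>(2)[OF this] have M: "M summable_on I"
      unfolding M_def I_def by (rule summable_on_cmult_right)
    have le: "norm (kernel_term N x l t) \<le> M l" if "t \<in> S" for l t
      unfolding M_def n by (rule norm_kernel_term_le[OF bounds[OF that]])
    have summable: "(\<lambda>l. kernel_term N x l t) summable_on I" if "t \<in> S" for t
      by (rule abs_summable_summable[OF summable_on_comparison_test[OF M le[OF that] norm_ge_zero]])
    have f: "((\<lambda>l. kernel_term N x l t) has_sum f t) I" if "t \<in> S" for t
    proof -
      have "norm (x (Suc N)) < 1 / K"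
        using x n by auto
      then have "norm (x (Suc N)) * K < 1"
        using \<open>K > 0\<close> by (simp add: field_simps)
      moreover have "norm (x (Suc N) * t) \<le> norm (x (Suc N)) * K"
        unfolding norm_mult by (intro mult_left_mono bounds(1)[OF that] norm_ge_zero)
      ultimately have "norm (x (Suc N) * t) < 1"
        by linarith
      from infsum_kernel_term[of x N t, OF this] summable[OF that]
      have "(\<Sum>\<^sub>\<infinity>l\<in>I. kernel_term N x l t) = f t"
        by (simp add: f_def I_def n)
      then show ?thesis
        using has_sum_infsum[OF summable[OF that]] by simp
    qed
    \<comment> \<open>The M-test is run along the filter of finite subsets of \<open>I\<close>, so
      no enumeration of the multi-indices is chosen.\<close>
    have lim: "uniform_limit S (\<lambda>X t. \<Sum>l\<in>X. kernel_term N x l t) f (finite_subsets_at_top I)"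
      using le f M by (rule Weierstrass_m_test_general')
    have "kernel_term N x l holomorphic_on S" for l
      unfolding kernel_term_def using S(3) by (intro holomorphic_intros) auto
    then have hol: "\<forall>\<^sub>F X in finite_subsets_at_top I. (\<lambda>t. \<Sum>l\<in>X. kernel_term N x l t) holomorphic_on S"
      by (intro always_eventually allI holomorphic_on_sum)
    have nontriv: "finite_subsets_at_top I \<noteq> bot"
      by simp
    have "f holomorphic_on S"
      by (rule holomorphic_on_uniform_limit[OF S(1) hol lim nontriv])
    then have "f contour_integrable_on \<gamma>"
      by (rule contour_integrable_holomorphic_simple[OF _ S(1) assms(2) S(2)])
    moreover have "G n x = 1 / (2 * of_real pi * \<i>) * contour_integral \<gamma> f"
    proof -
      have "((\<lambda>X. contour_integral \<gamma> (\<lambda>t. \<Sum>l\<in>X. kernel_term N x l t)) \<longlongrightarrow> contour_integral \<gamma> f)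
          (finite_subsets_at_top I)"
        by (rule contour_integral_uniform_limit_holomorphic[OF S(1) hol lim nontriv assms(2) S(2)])
      moreover have "\<forall>\<^sub>F X in finite_subsets_at_top I.
          contour_integral \<gamma> (\<lambda>t. \<Sum>l\<in>X. kernel_term N x l t) = (\<Sum>l\<in>X. 2 * pi * \<i> * G_term n x l)"
        unfolding n
        by (intro eventually_finite_subsets_at_top_weakI contour_integral_unique
            has_contour_integral_sum has_contour_integral_kernel_term assms closed)
      \<comment> \<open>Convergence along this filter is by definition \<open>has_sum\<close>, so
        the limit of the termwise integrals is the sum defining \<open>G n x\<close>, times
        \<open>2 * pi * \<i>\<close>.\<close>
      ultimately have "((\<lambda>l. 2 * pi * \<i> * G_term n x l) has_sum contour_integral \<gamma> f) I"
        unfolding has_sum_def by (rule Lim_transform_eventually)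
      then have "contour_integral \<gamma> f = 2 * pi * \<i> * G n x"
        unfolding G_def I_def infsum_cmult_right'[symmetric] by (rule infsumI[symmetric])
      then show ?thesis
        by simp
    qed
    ultimately show "(\<lambda>t. G (n - 1) (\<lambda>i. t * x i / ((t - 1) * (1 - x n * t))) * (1 / ((t - 1) * (1 - x n * t))))
        contour_integrable_on \<gamma> \<and>
      G n x = 1 / (2 * of_real pi * \<i>) *
        contour_integral \<gamma>
          (\<lambda>t. G (n - 1) (\<lambda>i. t * x i / ((t - 1) * (1 - x n * t))) *
                (1 / ((t - 1) * (1 - x n * t))))"
      unfolding f_def[abs_def] by blast
  qed
qed

end
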